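(* Let $G$ be a finite simple graph such that $G$ contains no induced subgraph isomorphic to the path $P_8$ on eight vertices, and such that every vertex of $G$ has degree at least $3$. Then $G$ contains a cycle of length $4$ or a cycle of length $8$ (not necessarily induced).
   Context: All graphs are finite, undirected and simple. $P_k$ denotes the path on $k$ vertices. A graph is $H$-free if it has no induced subgraph isomorphic to $H$. *)

theory Defs
  imports "Graph_Theory.Graph_Theory"
begin

text \<open>
  A finite simple undirected graph is a \<^term>\<open>graph\<close> of the library: a finite symmetric
  digraph without loops and without parallel arcs. Every undirected edge is represented by
  its two opposite arcs, so the degree of a vertex is its \<^term>\<open>out_degree\<close>.
\<close>

text \<open>The path on \<open>k\<close> vertices \<open>0, \<dots>, k - 1\<close>; it has \<open>k - 1\<close> edges.\<close>
definition path_graph :: "nat \<Rightarrow> (nat, nat \<times> nat) pre_digraph" where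
  "path_graph k = with_proj
     \<lparr> pverts = {..<k}, parcs = {(i, j). i < k \<and> j < k \<and> (j = Suc i \<or> i = Suc j)} \<rparr>"

lemma graph_path_graph: "graph (path_graph k)"
proof -
  have "{(i, j). i < k \<and> j < k \<and> (j = Suc i \<or> i = Suc j)} \<subseteq> {..<k} \<times> {..<k}"
    by auto
  then have "finite {(i, j). i < k \<and> j < k \<and> (j = Suc i \<or> i = Suc j)}"
    by (rule finite_subset) simp
  then have "pair_graph
      \<lparr> pverts = {..<k}, parcs = {(i, j). i < k \<and> j < k \<and> (j = Suc i \<or> i = Suc j)} \<rparr>"
    by unfold_locales (auto simp: symmetric_def intro!: symI)
  then show ?thesis
    unfolding path_graph_def by (rule pair_graph.pair_graphD_graph)
qed

definition induced_free :: "('c, 'd) pre_digraph \<Rightarrow> ('a, 'b) pre_digraph \<Rightarrow> bool" where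
  "induced_free H G \<longleftrightarrow> \<not> (\<exists>K. induced_subgraph K G \<and> digraph_iso K H)"

text \<open>
  The library's \<^term>\<open>pre_digraph.cycle\<close> is a closed arc walk without repeated vertices. In a
  symmetric digraph it also admits the walk \<open>u, v, u\<close> of length 2, which is not a cycle of an
  undirected graph; hence the bound on the length.
\<close>
definition has_cycle_of_length :: "('a, 'b) pre_digraph \<Rightarrow> nat \<Rightarrow> bool" where
  "has_cycle_of_length G n \<longleftrightarrow> 3 \<le> n \<and> (\<exists>p. pre_digraph.cycle G p \<and> length p = n)"

end

theory Submission
  imports Defs
begin

text \<open>
  Let \<open>k\<close> be such that \<open>G\<close> has an induced path on \<open>k\<close> but none on \<open>k + 1\<close> vertices; \<open>2 \<le> k \<le> 7\<close>.
  Start from an induced path on \<open>k\<close> vertices. A known vertex with fewer than three known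
  neighbours, all of whose adjacencies to the known vertices are settled, has a neighbour that is
  a new vertex; the adjacencies of the new vertex are then settled by case distinctions. In each
  of the six cases every branch soon contains a cycle of length 4 or 8 or an induced path on
  \<open>k + 1\<close> vertices. The case trees were found by a computer search.
\<close>

section \<open>Case trees and their verification\<close>

text \<open>The parameter \<open>k\<close> has to vary because the absence of an induced path on
  eight vertices guarantees no induced path on seven to start from. Within the case
  \<open>k\<close>, the excluded path on \<open>k + 1\<close> vertices takes over the role of the
  excluded path on eight. Two facts keep the branching small. Without 4-cycles two vertices have at
  most one common neighbour, so most candidate adjacencies of a new vertex are refuted at once. And
  a new neighbour of an end of an induced path on \<open>k\<close> vertices must be adjacent to a
  further vertex of that path, as otherwise the path becomes longer. Adjacencies of a vertex are
  settled before it receives a neighbour since only then is that neighbour certain to differ from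
  all known vertices. Other pairs may stay undecided: a cycle need not be induced, so a cycle leaf
  uses adjacencies only, and a path leaf uses only the pairs on its own path. Knowledge of adjacency
  and knowledge of non-adjacency are therefore two separate relations throughout.\<close>

fun induced_path :: "('v \<Rightarrow> 'v \<Rightarrow> bool) \<Rightarrow> ('v \<Rightarrow> 'v \<Rightarrow> bool) \<Rightarrow> 'v list \<Rightarrow> bool" where
  "induced_path R S (u # v # vs) \<longleftrightarrow> R u v \<and> list_all (S u) vs \<and> induced_path R S (v # vs)"
| "induced_path R S _ \<longleftrightarrow> True"

text \<open>Distinctness is left out on purpose: passing from numbers to vertices of the graph
  preserves it only for injective maps, so it is transferred separately.\<close>

definition closed_walk :: "('v \<Rightarrow> 'v \<Rightarrow> bool) \<Rightarrow> 'v list \<Rightarrow> bool" where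
  "closed_walk R vs \<longleftrightarrow> successively R vs \<and> R (last vs) (hd vs)"

text \<open>Both relations occur only positively in \<open>induced_path\<close>. So a path checked
  against the two lists of known pairs carries over to the graph, where \<open>S'\<close> is the
  negation of \<open>R'\<close>; with one relation and its complement there would be no such
  monotonicity.\<close>

lemma induced_path_map_mono:
  assumes "induced_path R S vs"
    and "\<And>u v. u \<in> set vs \<Longrightarrow> v \<in> set vs \<Longrightarrow> R u v \<Longrightarrow> R' (f u) (f v)"
    and "\<And>u v. u \<in> set vs \<Longrightarrow> v \<in> set vs \<Longrightarrow> S u v \<Longrightarrow> S' (f u) (f v)"
  shows "induced_path R' S' (map f vs)"
  using assms by (induction R S vs rule: induced_path.induct) (auto simp: list_all_iff)

text \<open>Nonemptiness is what lets \<open>map f\<close> commute with \<open>hd\<close> and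
  \<open>last\<close> in the closing edge.\<close>

lemma closed_walk_map_mono:
  assumes "closed_walk R vs" "vs \<noteq> []"
    and "\<And>u v. u \<in> set vs \<Longrightarrow> v \<in> set vs \<Longrightarrow> R u v \<Longrightarrow> R' (f u) (f v)"
  shows "closed_walk R' (map f vs)"
proof -
  have "successively (\<lambda>u v. R' (f u) (f v)) vs"
    using assms by (auto simp: closed_walk_def intro: successively_mono)
  moreover have "R' (f (last vs)) (f (hd vs))"
    using assms by (auto simp: closed_walk_def)
  ultimately show ?thesis
    using assms(2) by (simp add: closed_walk_def successively_map last_map hd_map)
qed

text \<open>The recursive form serves evaluation. The indexed form serves the arguments in which the
  position on the path is itself the name of the vertex.\<close>

lemma induced_path_conv_nth:
  "induced_path R S vs \<longleftrightarrow>
     (\<forall>i. Suc i < length vs \<longrightarrow> R (vs ! i) (vs ! Suc i)) \<and>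
     (\<forall>i j. Suc i < j \<longrightarrow> j < length vs \<longrightarrow> S (vs ! i) (vs ! j))"
proof (induction R S vs rule: induced_path.induct)
  case (1 R S u v vs)
  let ?edges = "\<lambda>vs. \<forall>i. Suc i < length vs \<longrightarrow> R (vs ! i) (vs ! Suc i)"
  let ?nonedges = "\<lambda>vs. \<forall>i j. Suc i < j \<longrightarrow> j < length vs \<longrightarrow> S (vs ! i) (vs ! j)"
  have "?edges (u # v # vs) \<longleftrightarrow> R u v \<and> ?edges (v # vs)"
    by (auto simp: less_Suc_eq_0_disj nth_Cons split: nat.split)
  moreover have "?nonedges (u # v # vs) \<longleftrightarrow> list_all (S u) vs \<and> ?nonedges (v # vs)"
  proof (intro iffI conjI allI impI)
    assume *: "?nonedges (u # v # vs)"
    show "list_all (S u) vs"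
      unfolding list_all_length using *[rule_format, of 0 "Suc (Suc _)"] by simp
    show "S ((v # vs) ! i) ((v # vs) ! j)" if "Suc i < j" "j < length (v # vs)" for i j
      using *[THEN spec, THEN spec, of "Suc i" "Suc j"] that by simp
  next
    fix i j
    assume *: "list_all (S u) vs \<and> ?nonedges (v # vs)" and ij: "Suc i < j" "j < length (u # v # vs)"
    obtain j' where j': "j = Suc (Suc j')"
      using ij(1) by (auto dest: less_imp_Suc_add)
    show "S ((u # v # vs) ! i) ((u # v # vs) ! j)"
    proof (cases i)
      case 0
      then show ?thesis
        using * ij j' by (simp add: list_all_length)
    next
      case (Suc i')
      then show ?thesis
        using conjunct2[OF *, rule_format, of i' "Suc j'"] ij j' by simp
    qed
  qed
  ultimately show ?case
    using "1.IH" by auto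
qed auto

section \<open>Certificates for the case distinctions and their checker\<close>

definition listed :: "(nat \<times> nat) list \<Rightarrow> nat \<Rightarrow> nat \<Rightarrow> bool" where
  "listed ps u v \<longleftrightarrow> List.member ps (u, v) \<or> List.member ps (v, u)"

text \<open>The trees are bare data without invariants. Nothing about their origin has to be
  trusted, since the checker below tests every leaf and the side conditions of every inner
  node.\<close>

datatype refutation =
  Cycle "nat list"
| Path "nat list"
| Split nat nat refutation refutation
| Grow nat refutation

text \<open>
  The known vertices are \<open>0, \<dots>, n - 1\<close>; the lists \<open>E\<close> and \<open>N\<close> contain the pairs known to be
  adjacent and known to be non-adjacent. \<open>Grow v\<close> adds the vertex \<open>n\<close>, adjacent to \<open>v\<close>.
\<close>
fun refutes :: "nat \<Rightarrow> nat \<Rightarrow> (nat \<times> nat) list \<Rightarrow> (nat \<times> nat) list \<Rightarrow> refutation \<Rightarrow> bool" where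
  "refutes l n E N (Cycle vs) \<longleftrightarrow>
     (length vs = 4 \<or> length vs = 8) \<and> distinct vs \<and> list_all (\<lambda>v. v < n) vs \<and>
     closed_walk (listed E) vs"
| "refutes l n E N (Path vs) \<longleftrightarrow>
     length vs = l \<and> distinct vs \<and> list_all (\<lambda>v. v < n) vs \<and>
     induced_path (listed E) (listed N) vs"
| "refutes l n E N (Split u v r s) \<longleftrightarrow>
     u < n \<and> v < n \<and> refutes l n ((u, v) # E) N r \<and> refutes l n E ((u, v) # N) s"
| "refutes l n E N (Grow v r) \<longleftrightarrow>
     v < n \<and> list_all (\<lambda>u. u = v \<or> listed E v u \<or> listed N v u) [0..<n] \<and>
     length (filter (listed E v) [0..<n]) < 3 \<and> refutes l (Suc n) ((n, v) # E) N r"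

section \<open>Initial knowledge, embeddings into the graph, and soundness of the checker\<close>

definition path_edges :: "nat \<Rightarrow> (nat \<times> nat) list" where
  "path_edges k = map (\<lambda>i. (i, Suc i)) [0..<k - 1]"

definition path_nonedges :: "nat \<Rightarrow> (nat \<times> nat) list" where
  "path_nonedges k = [(i, j). i \<leftarrow> [0..<k], j \<leftarrow> [i + 2..<k]]"

text \<open>The map \<open>f\<close> embeds the known part into the graph. The bounds on listed
  pairs ensure that redefining \<open>f\<close> at the next number \<open>n\<close> disturbs no
  recorded fact; injectivity turns distinct numbers into distinct vertices.\<close>

definition realizes :: "('v \<Rightarrow> 'v \<Rightarrow> bool) \<Rightarrow> 'v set \<Rightarrow> nat \<Rightarrow> (nat \<times> nat) list \<Rightarrow> (nat \<times> nat) list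
    \<Rightarrow> (nat \<Rightarrow> 'v) \<Rightarrow> bool" where
  "realizes adj V n E N f \<longleftrightarrow> inj_on f {..<n} \<and> f ` {..<n} \<subseteq> V \<and>
     (\<forall>(u, v) \<in> set E. u < n \<and> v < n \<and> adj (f u) (f v)) \<and>
     (\<forall>(u, v) \<in> set N. u < n \<and> v < n \<and> \<not> adj (f u) (f v))"

text \<open>Symmetry of \<open>adj\<close> is needed because \<open>listed\<close> ignores the
  orientation in which a pair was recorded.\<close>

lemma realizes_adj:
  assumes "realizes adj V n E N f" "symp adj" "listed E u v"
  shows "u < n" "v < n" "adj (f u) (f v)"
  using assms by (auto simp: realizes_def listed_def dest: sympD)

lemma realizes_nonadj:
  assumes "realizes adj V n E N f" "symp adj" "listed N u v"
  shows "u < n" "v < n" "\<not> adj (f u) (f v)"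
  using assms by (auto simp: realizes_def listed_def dest: sympD)

text \<open>The graph itself chooses a branch of the tree: at a \<open>Split\<close> the actual
  adjacency selects the subtree and \<open>f\<close> stays the same, at a \<open>Grow\<close> the
  degree bound supplies a vertex by which \<open>f\<close> is extended. The leaf that is reached
  contradicts \<open>no_cycle\<close> or \<open>no_path\<close>. As \<open>n\<close>,
  \<open>E\<close>, \<open>N\<close> and \<open>f\<close> change on the way, the induction is over
  arbitrary ones.\<close>

lemma refutes_sound:
  fixes adj :: "'v \<Rightarrow> 'v \<Rightarrow> bool"
  assumes sym: "symp adj" and irrefl: "irreflp adj"
    and closed: "\<And>u v. adj u v \<Longrightarrow> v \<in> V"
    and deg: "\<And>v. v \<in> V \<Longrightarrow> 3 \<le> card {w. adj v w}"
    and no_cycle: "\<And>vs. length vs = 4 \<or> length vs = 8 \<Longrightarrow> distinct vs \<Longrightarrow> \<not> closed_walk adj vs"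
    and no_path: "\<And>vs. length vs = l \<Longrightarrow> distinct vs \<Longrightarrow> set vs \<subseteq> V \<Longrightarrow>
      \<not> induced_path adj (\<lambda>u v. \<not> adj u v) vs"
    and "refutes l n E N r" "realizes adj V n E N f"
  shows False
  using assms(7,8)
proof (induction r arbitrary: n E N f)
  case (Cycle vs)
  have "closed_walk adj (map f vs)"
    using Cycle.prems realizes_adj[OF Cycle.prems(2) sym]
    by (intro closed_walk_map_mono[where R = "listed E"]) auto
  moreover have "distinct (map f vs)"
    using Cycle.prems
    by (auto simp: distinct_map realizes_def list_all_iff intro: inj_on_subset)
  ultimately show False
    using Cycle.prems no_cycle[of "map f vs"] by auto
next
  case (Path vs)
  have "induced_path adj (\<lambda>u v. \<not> adj u v) (map f vs)"
    using Path.prems realizes_adj[OF Path.prems(2) sym] realizes_nonadj[OF Path.prems(2) sym]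
    by (intro induced_path_map_mono[where R = "listed E" and S = "listed N"]) auto
  moreover have "distinct (map f vs)"
    using Path.prems
    by (auto simp: distinct_map realizes_def list_all_iff intro: inj_on_subset)
  moreover have "set (map f vs) \<subseteq> V"
    using Path.prems by (auto simp: realizes_def list_all_iff)
  ultimately show False
    using Path.prems no_path[of "map f vs"] by auto
next
  case (Split u v r s)
  show False
  proof (cases "adj (f u) (f v)")
    case True
    then have "realizes adj V n ((u, v) # E) N f"
      using Split.prems by (auto simp: realizes_def)
    then show False
      using Split.IH(1)[of n "(u, v) # E" N f] Split.prems(1) by simp
  next
    case False
    then have "realizes adj V n E ((u, v) # N) f"
      using Split.prems by (auto simp: realizes_def)
    then show False
      using Split.IH(2)[of n E "(u, v) # N" f] Split.prems(1) by simp
  qed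
next
  case (Grow v r)
  define A where "A = f ` set (filter (listed E v) [0..<n])"
  have v: "v < n" "f v \<in> V" and r: "refutes l (Suc n) ((n, v) # E) N r"
    using Grow.prems by (auto simp: realizes_def)
  have "card A < card {w. adj (f v) w}"
  proof -
    \<comment> \<open>Taking the set of a list and then its image can only decrease the count, so
      injectivity plays no part in this bound.\<close>
    have "card A \<le> length (filter (listed E v) [0..<n])"
      unfolding A_def by (metis card_image_le card_length finite_set le_trans)
    also have "\<dots> < 3"
      using Grow.prems(1) by simp
    also have "3 \<le> card {w. adj (f v) w}"
      using deg v(2) by blast
    finally show ?thesis .
  qed
  then obtain x where x: "adj (f v) x" "x \<notin> A"
    by (metis A_def List.finite_set card_mono finite_imageI leD mem_Collect_eq subsetI)
  \<comment> \<open>Each way of settling \<open>u\<close> excludes \<open>x = f u\<close>: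
    \<open>u = v\<close> by irreflexivity, a listed edge because \<open>x\<close> lies outside
    \<open>A\<close>, a listed non-edge because \<open>x\<close> is adjacent to
    \<open>f v\<close>.\<close>
  have new: "x \<noteq> f u" if "u < n" for u
  proof
    assume "x = f u"
    have "u = v \<or> listed E v u \<or> listed N v u"
      using Grow.prems(1) that by (auto simp: list_all_iff)
    then show False
      using x \<open>x = f u\<close> that irrefl realizes_nonadj[OF Grow.prems(2) sym, of v u]
      by (auto simp: A_def irreflp_def)
  qed
  have "inj_on (f(n := x)) {..<Suc n}" "(f(n := x)) ` {..<Suc n} \<subseteq> V"
    using Grow.prems(2) new closed[OF x(1)]
    by (auto simp: realizes_def lessThan_Suc inj_on_def)
  moreover have "\<forall>(u, w) \<in> set E. u < n \<and> w < n \<and> adj (f u) (f w)"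
    and "\<forall>(u, w) \<in> set N. u < n \<and> w < n \<and> \<not> adj (f u) (f w)"
    using Grow.prems(2) by (auto simp: realizes_def)
  moreover have "adj x (f v)"
    using x(1) sym by (auto dest: sympD)
  ultimately have "realizes adj V (Suc n) ((n, v) # E) N (f(n := x))"
    unfolding realizes_def using v(1) by (auto simp: case_prod_unfold)
  then show False
    using Grow.IH r by blast
qed

text \<open>This provides the root of a case tree: number \<open>i\<close> stands for the vertex at
  position \<open>i\<close> of the given path.\<close>

lemma realizes_path:
  assumes "induced_path adj (\<lambda>u v. \<not> adj u v) vs" "distinct vs" "set vs \<subseteq> V"
  shows "realizes adj V (length vs) (path_edges (length vs)) (path_nonedges (length vs)) ((!) vs)"
  using assms unfolding realizes_def induced_path_conv_nth path_edges_def path_nonedges_def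
  by (auto simp: inj_on_def nth_eq_iff_index_eq)

section \<open>The case trees\<close>

text \<open>Two further neighbours 2 and 3 of 1 must both be adjacent to 0, since otherwise an
  induced path on three vertices appears. Then 0 and 1 have two common neighbours.\<close>

definition refutation_2 :: refutation where
  "refutation_2 =
    Grow 1 (Split 2 0 (Grow 1 (Split 3 0 (Cycle [3, 1, 2, 0]) (Path [0, 1, 3]))) (Path [0, 1, 2]))"

text \<open>The one surviving branch has the triangle 1, 2, 3. There 0, 1, 3 is again an induced
  path, and a third neighbour 4 of its end 3 either closes a 4-cycle or extends it. Whether 4 and 2
  are adjacent is never asked.\<close>

definition refutation_3 :: refutation where
  "refutation_3 =
    Grow 2 (Split 3 0 (Cycle [3, 2, 1, 0]) (Split 3 1 (Grow 3 (Split 4 0 (Cycle [4, 3, 1, 0])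
    (Split 4 1 (Cycle [4, 3, 2, 1]) (Path [0, 1, 3, 4])))) (Path [0, 1, 2, 3])))"

text \<open>Up to this tree all cycle leaves have length 4; cycles of length 8 enter only with the
  longer starting paths.\<close>

definition refutation_4 :: refutation where
  "refutation_4 =
    Grow 0 (Split 4 2 (Cycle [4, 0, 1, 2]) (Split 4 3 (Grow 0 (Split 5 2 (Cycle [5, 0, 1, 2])
    (Split 5 3 (Cycle [5, 0, 4, 3]) (Split 5 1 (Split 5 4 (Cycle [5, 1, 0, 4])
    (Path [2, 3, 4, 0, 5])) (Path [3, 2, 1, 0, 5]))))) (Split 4 1 (Grow 4 (Split 5 0
    (Cycle [5, 4, 1, 0]) (Split 5 1 (Cycle [5, 4, 0, 1]) (Split 5 2 (Cycle [5, 4, 1, 2])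
    (Split 5 3 (Path [0, 1, 2, 3, 5]) (Path [3, 2, 1, 4, 5])))))) (Path [3, 2, 1, 0, 4]))))"

text \<open>Growing at the middle of the path is economical: adjacency of 5 to either end closes a
  4-cycle, and so does adjacency to both 1 and 3.\<close>

definition refutation_5 :: refutation where
  "refutation_5 =
    Grow 2 (Split 5 0 (Cycle [5, 2, 1, 0]) (Split 5 4 (Cycle [5, 2, 3, 4]) (Split 5 3 (Split 5 1
    (Cycle [5, 3, 2, 1]) (Grow 4 (Split 6 2 (Cycle [6, 4, 3, 2]) (Split 6 5 (Cycle [6, 4, 3, 5])
    (Split 6 1 (Split 6 3 (Cycle [6, 1, 2, 3]) (Split 6 0 (Grow 4 (Split 7 0 (Cycle [7, 4, 6, 0])
    (Split 7 1 (Cycle [7, 4, 6, 1]) (Split 7 2 (Cycle [7, 4, 3, 2]) (Split 7 3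
    (Cycle [7, 4, 6, 0, 1, 2, 5, 3]) (Path [0, 1, 2, 3, 4, 7])))))) (Path [0, 1, 6, 4, 3, 5])))
    (Split 6 0 (Path [4, 6, 0, 1, 2, 5]) (Split 6 3 (Grow 6 (Split 7 0
    (Cycle [7, 6, 4, 3, 5, 2, 1, 0]) (Split 7 2 (Cycle [7, 6, 3, 2]) (Split 7 3
    (Cycle [7, 6, 4, 3]) (Split 7 1 (Split 7 5 (Cycle [7, 1, 2, 5]) (Path [0, 1, 7, 6, 3, 5]))
    (Path [0, 1, 2, 3, 6, 7])))))) (Path [0, 1, 2, 3, 4, 6])))))))) (Split 5 1 (Grow 0 (Split 6 2
    (Cycle [6, 0, 1, 2]) (Split 6 5 (Cycle [6, 0, 1, 5]) (Split 6 3 (Split 6 1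
    (Cycle [6, 3, 2, 1]) (Split 6 4 (Grow 0 (Split 7 1 (Cycle [7, 0, 6, 4, 3, 2, 5, 1]) (Split 7 2
    (Cycle [7, 0, 1, 2]) (Split 7 3 (Cycle [7, 0, 6, 3]) (Split 7 4 (Cycle [7, 0, 6, 4])
    (Path [4, 3, 2, 1, 0, 7])))))) (Path [4, 3, 6, 0, 1, 5]))) (Split 6 4
    (Path [0, 6, 4, 3, 2, 5]) (Split 6 1 (Grow 0 (Split 7 1 (Cycle [7, 0, 6, 1]) (Split 7 2
    (Cycle [7, 0, 1, 2]) (Split 7 4 (Cycle [7, 0, 6, 1, 5, 2, 3, 4]) (Split 7 3 (Split 7 5
    (Cycle [7, 0, 1, 5]) (Path [4, 3, 7, 0, 1, 5])) (Path [4, 3, 2, 1, 0, 7]))))))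
    (Path [4, 3, 2, 1, 0, 6]))))))) (Grow 0 (Split 6 2 (Cycle [6, 0, 1, 2]) (Split 6 3 (Split 6 5
    (Cycle [6, 3, 2, 5]) (Grow 0 (Split 7 2 (Cycle [7, 0, 1, 2]) (Split 7 3 (Cycle [7, 0, 6, 3])
    (Split 7 5 (Split 7 1 (Cycle [7, 5, 2, 1]) (Split 7 4 (Cycle [7, 5, 2, 1, 0, 6, 3, 4])
    (Path [4, 3, 2, 1, 0, 7]))) (Split 7 4 (Path [0, 7, 4, 3, 2, 5]) (Split 7 1 (Split 7 6
    (Cycle [7, 1, 0, 6]) (Path [5, 2, 3, 6, 0, 7])) (Path [4, 3, 2, 1, 0, 7])))))))) (Split 6 4
    (Split 6 5 (Grow 0 (Split 7 2 (Cycle [7, 0, 1, 2]) (Split 7 3 (Cycle [7, 0, 1, 2, 5, 6, 4, 3])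
    (Split 7 4 (Cycle [7, 0, 6, 4]) (Split 7 1 (Split 7 6 (Cycle [7, 1, 0, 6])
    (Path [2, 3, 4, 6, 0, 7])) (Path [4, 3, 2, 1, 0, 7])))))) (Path [0, 6, 4, 3, 2, 5]))
    (Split 6 1 (Split 6 5 (Cycle [6, 1, 2, 5]) (Grow 0 (Split 7 1 (Cycle [7, 0, 6, 1]) (Split 7 2
    (Cycle [7, 0, 1, 2]) (Split 7 6 (Cycle [7, 0, 1, 6]) (Split 7 5 (Split 7 3
    (Cycle [7, 5, 2, 3]) (Path [3, 2, 5, 7, 0, 6])) (Split 7 3 (Path [5, 2, 3, 7, 0, 6])
    (Split 7 4 (Path [4, 7, 0, 1, 2, 5]) (Path [4, 3, 2, 1, 0, 7])))))))))
    (Path [4, 3, 2, 1, 0, 6]))))))))))"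

text \<open>Vertex 3 has path vertices at distance two on both sides, so two of the five open
  adjacencies of 6 close a 4-cycle at once. No branch adds more than five vertices.\<close>

definition refutation_6 :: refutation where
  "refutation_6 =
    Grow 3 (Split 6 1 (Cycle [6, 3, 2, 1]) (Split 6 5 (Cycle [6, 3, 4, 5]) (Split 6 2 (Split 6 0
    (Cycle [6, 2, 1, 0]) (Split 6 4 (Cycle [6, 2, 3, 4]) (Grow 6 (Split 7 1 (Cycle [7, 6, 2, 1])
    (Split 7 2 (Cycle [7, 6, 3, 2]) (Split 7 3 (Cycle [7, 6, 2, 3]) (Split 7 4
    (Cycle [7, 6, 3, 4]) (Split 7 5 (Split 7 0 (Cycle [7, 5, 4, 3, 6, 2, 1, 0])
    (Path [0, 1, 2, 3, 4, 5, 7])) (Split 7 0 (Path [5, 4, 3, 2, 1, 0, 7]) (Grow 0 (Split 8 2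
    (Cycle [8, 0, 1, 2]) (Split 8 5 (Cycle [8, 0, 1, 2, 6, 3, 4, 5]) (Split 8 6 (Split 8 1
    (Cycle [8, 6, 2, 1]) (Split 8 3 (Cycle [8, 6, 2, 3]) (Split 8 4 (Cycle [8, 6, 3, 4])
    (Path [5, 4, 3, 2, 1, 0, 8])))) (Split 8 3 (Split 8 1 (Cycle [8, 3, 2, 1]) (Split 8 4
    (Path [5, 4, 8, 0, 1, 2, 6]) (Split 8 7 (Cycle [8, 3, 6, 7]) (Grow 8 (Split 9 1
    (Cycle [9, 8, 0, 1]) (Split 9 2 (Cycle [9, 8, 3, 2]) (Split 9 4 (Cycle [9, 8, 3, 4])
    (Split 9 5 (Cycle [9, 8, 0, 1, 2, 3, 4, 5]) (Split 9 6 (Cycle [9, 8, 3, 6]) (Split 9 7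
    (Cycle [9, 8, 0, 1, 2, 3, 6, 7]) (Split 9 0 (Split 9 3 (Cycle [9, 0, 8, 3])
    (Path [5, 4, 3, 2, 1, 0, 9])) (Path [7, 6, 2, 1, 0, 8, 9])))))))))))) (Split 8 4 (Split 8 1
    (Split 8 7 (Grow 0 (Split 9 1 (Cycle [9, 0, 8, 1]) (Split 9 2 (Cycle [9, 0, 1, 2]) (Split 9 3
    (Cycle [9, 0, 1, 8, 7, 6, 2, 3]) (Split 9 4 (Cycle [9, 0, 8, 4]) (Split 9 5
    (Cycle [9, 0, 1, 2, 6, 3, 4, 5]) (Path [5, 4, 3, 2, 1, 0, 9])))))))
    (Path [5, 4, 8, 1, 2, 6, 7])) (Path [5, 4, 8, 0, 1, 2, 6])) (Split 8 1 (Split 8 7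
    (Path [5, 4, 3, 2, 1, 8, 7]) (Grow 8 (Split 9 0 (Cycle [9, 8, 1, 0]) (Split 9 1
    (Cycle [9, 8, 0, 1]) (Split 9 2 (Cycle [9, 8, 1, 2]) (Split 9 4
    (Cycle [9, 8, 0, 1, 2, 6, 3, 4]) (Split 9 5 (Cycle [9, 8, 0, 1, 2, 3, 4, 5]) (Split 9 3
    (Split 9 6 (Cycle [9, 3, 2, 6]) (Split 9 7 (Cycle [9, 3, 6, 7]) (Grow 9 (Split 10 1
    (Cycle [10, 9, 8, 1]) (Split 10 2 (Cycle [10, 9, 3, 2]) (Split 10 6 (Cycle [10, 9, 3, 6])
    (Split 10 7 (Cycle [10, 9, 8, 0, 1, 2, 6, 7]) (Split 10 8 (Cycle [10, 9, 3, 6, 2, 1, 0, 8])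
    (Path [7, 6, 2, 1, 8, 9, 10]))))))))) (Path [5, 4, 3, 2, 1, 8, 9])))))))))
    (Path [5, 4, 3, 2, 1, 0, 8]))))))))))))))))) (Split 6 0 (Grow 5 (Split 7 2
    (Cycle [7, 5, 4, 3, 6, 0, 1, 2]) (Split 7 3 (Cycle [7, 5, 4, 3]) (Split 7 6
    (Cycle [7, 5, 4, 3, 2, 1, 0, 6]) (Split 7 0 (Grow 5 (Split 8 0 (Cycle [8, 5, 7, 0]) (Split 8 1
    (Cycle [8, 5, 7, 0, 6, 3, 2, 1]) (Split 8 2 (Cycle [8, 5, 4, 3, 6, 0, 1, 2]) (Split 8 3
    (Cycle [8, 5, 4, 3]) (Split 8 4 (Cycle [8, 5, 7, 0, 1, 2, 3, 4])
    (Path [0, 1, 2, 3, 4, 5, 8]))))))) (Split 7 1 (Grow 5 (Split 8 0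
    (Cycle [8, 5, 7, 1, 2, 3, 6, 0]) (Split 8 1 (Cycle [8, 5, 7, 1]) (Split 8 2
    (Cycle [8, 5, 4, 3, 6, 0, 1, 2]) (Split 8 3 (Cycle [8, 5, 4, 3]) (Split 8 4
    (Cycle [8, 5, 7, 1, 0, 6, 3, 4]) (Path [0, 1, 2, 3, 4, 5, 8]))))))) (Split 7 4 (Grow 7
    (Split 8 0 (Cycle [8, 7, 5, 4, 3, 2, 1, 0]) (Split 8 1 (Cycle [8, 7, 5, 4, 3, 6, 0, 1])
    (Split 8 2 (Cycle [8, 7, 4, 3, 6, 0, 1, 2]) (Split 8 3 (Cycle [8, 7, 4, 3]) (Split 8 4
    (Cycle [8, 7, 5, 4]) (Path [0, 1, 2, 3, 4, 7, 8]))))))) (Path [0, 1, 2, 3, 4, 5, 7]))))))))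
    (Split 6 4 (Grow 5 (Split 7 0 (Cycle [7, 5, 4, 6, 3, 2, 1, 0]) (Split 7 3 (Cycle [7, 5, 4, 3])
    (Split 7 6 (Cycle [7, 5, 4, 6]) (Split 7 2 (Split 7 4 (Cycle [7, 2, 3, 4]) (Split 7 1 (Grow 5
    (Split 8 0 (Cycle [8, 5, 4, 6, 3, 2, 1, 0]) (Split 8 1 (Cycle [8, 5, 7, 1]) (Split 8 2
    (Cycle [8, 5, 7, 2]) (Split 8 3 (Cycle [8, 5, 4, 3]) (Split 8 4
    (Cycle [8, 5, 7, 1, 2, 3, 6, 4]) (Path [0, 1, 2, 3, 4, 5, 8])))))))
    (Path [0, 1, 2, 7, 5, 4, 6]))) (Split 7 1 (Split 7 4 (Grow 5 (Split 8 0
    (Cycle [8, 5, 4, 6, 3, 2, 1, 0]) (Split 8 1 (Cycle [8, 5, 7, 1]) (Split 8 3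
    (Cycle [8, 5, 4, 3]) (Split 8 4 (Cycle [8, 5, 7, 4]) (Split 8 2 (Split 8 6
    (Cycle [8, 2, 3, 6]) (Path [0, 1, 2, 8, 5, 4, 6])) (Path [0, 1, 2, 3, 4, 5, 8]))))))) (Grow 2
    (Split 8 0 (Cycle [8, 2, 1, 0]) (Split 8 1 (Cycle [8, 2, 3, 6, 4, 5, 7, 1]) (Split 8 4
    (Cycle [8, 2, 3, 4]) (Split 8 6 (Cycle [8, 2, 3, 6]) (Split 8 5 (Path [0, 1, 2, 8, 5, 4, 6])
    (Split 8 7 (Cycle [8, 2, 1, 7]) (Path [6, 4, 5, 7, 1, 2, 8]))))))))) (Split 7 4 (Grow 5
    (Split 8 0 (Cycle [8, 5, 4, 6, 3, 2, 1, 0]) (Split 8 1 (Cycle [8, 5, 7, 4, 6, 3, 2, 1])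
    (Split 8 3 (Cycle [8, 5, 4, 3]) (Split 8 4 (Cycle [8, 5, 7, 4]) (Split 8 2 (Split 8 6
    (Cycle [8, 2, 3, 6]) (Path [0, 1, 2, 8, 5, 4, 6])) (Path [0, 1, 2, 3, 4, 5, 8])))))))
    (Path [0, 1, 2, 3, 4, 5, 7])))))))) (Grow 5 (Split 7 3 (Cycle [7, 5, 4, 3]) (Split 7 2
    (Split 7 0 (Cycle [7, 2, 1, 0]) (Split 7 4 (Cycle [7, 2, 3, 4]) (Split 7 6
    (Cycle [7, 2, 3, 6]) (Split 7 1 (Path [0, 1, 7, 5, 4, 3, 6]) (Grow 0 (Split 8 2
    (Cycle [8, 0, 1, 2]) (Split 8 3 (Cycle [8, 0, 1, 2, 7, 5, 4, 3]) (Split 8 7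
    (Cycle [8, 0, 1, 2, 3, 4, 5, 7]) (Split 8 6 (Split 8 1 (Cycle [8, 6, 3, 4, 5, 7, 2, 1])
    (Split 8 4 (Cycle [8, 6, 3, 4]) (Split 8 5 (Grow 6 (Split 9 0 (Cycle [9, 6, 8, 0]) (Split 9 1
    (Cycle [9, 6, 3, 4, 5, 8, 0, 1]) (Split 9 2 (Cycle [9, 6, 3, 2]) (Split 9 4
    (Cycle [9, 6, 3, 4]) (Split 9 7 (Cycle [9, 6, 8, 5, 4, 3, 2, 7]) (Split 9 8 (Split 9 3
    (Cycle [9, 8, 6, 3]) (Path [4, 3, 2, 1, 0, 8, 9])) (Path [7, 2, 1, 0, 8, 6, 9]))))))))
    (Path [5, 4, 3, 2, 1, 0, 8])))) (Split 8 5 (Path [0, 8, 5, 7, 2, 3, 6]) (Split 8 1 (Split 8 4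
    (Grow 7 (Split 9 0 (Cycle [9, 7, 5, 4, 3, 2, 1, 0]) (Split 9 2
    (Cycle [9, 7, 5, 4, 8, 0, 1, 2]) (Split 9 3 (Cycle [9, 7, 2, 3]) (Split 9 4
    (Cycle [9, 7, 5, 4]) (Split 9 8 (Cycle [9, 7, 5, 4, 3, 2, 1, 8])
    (Path [0, 8, 4, 3, 2, 7, 9]))))))) (Grow 8 (Split 9 1 (Cycle [9, 8, 0, 1]) (Split 9 2
    (Cycle [9, 8, 1, 2]) (Split 9 3 (Cycle [9, 8, 1, 2, 7, 5, 4, 3]) (Split 9 4
    (Cycle [9, 8, 0, 1, 2, 7, 5, 4]) (Split 9 5 (Cycle [9, 8, 0, 1, 2, 3, 4, 5])
    (Path [5, 4, 3, 2, 1, 8, 9])))))))) (Split 8 4 (Grow 5 (Split 9 0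
    (Cycle [9, 5, 7, 2, 3, 4, 8, 0]) (Split 9 2 (Cycle [9, 5, 7, 2]) (Split 9 3
    (Cycle [9, 5, 4, 3]) (Split 9 4 (Cycle [9, 5, 7, 2, 1, 0, 8, 4]) (Split 9 1 (Split 9 6
    (Cycle [9, 1, 2, 7, 5, 4, 3, 6]) (Path [0, 1, 9, 5, 4, 3, 6]))
    (Path [0, 1, 2, 3, 4, 5, 9]))))))) (Path [5, 4, 3, 2, 1, 0, 8]))))))))))))) (Split 7 6
    (Split 7 4 (Cycle [7, 6, 3, 4]) (Split 7 1 (Split 7 0 (Grow 5 (Split 8 0 (Cycle [8, 5, 7, 0])
    (Split 8 1 (Cycle [8, 5, 7, 1]) (Split 8 2 (Cycle [8, 5, 4, 3, 6, 7, 1, 2]) (Split 8 3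
    (Cycle [8, 5, 4, 3]) (Split 8 4 (Cycle [8, 5, 7, 0, 1, 2, 3, 4])
    (Path [0, 1, 2, 3, 4, 5, 8]))))))) (Grow 5 (Split 8 0 (Cycle [8, 5, 7, 6, 3, 2, 1, 0])
    (Split 8 1 (Cycle [8, 5, 7, 1]) (Split 8 2 (Cycle [8, 5, 4, 3, 6, 7, 1, 2]) (Split 8 3
    (Cycle [8, 5, 4, 3]) (Split 8 4 (Split 8 6 (Cycle [8, 4, 3, 6]) (Split 8 7
    (Cycle [8, 4, 5, 7]) (Path [0, 1, 7, 6, 3, 4, 8]))) (Path [0, 1, 2, 3, 4, 5, 8]))))))))
    (Split 7 0 (Grow 1 (Split 8 0 (Cycle [8, 1, 2, 3, 4, 5, 7, 0]) (Split 8 3 (Cycle [8, 1, 2, 3])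
    (Split 8 4 (Cycle [8, 1, 2, 3, 6, 7, 5, 4]) (Split 8 5 (Cycle [8, 1, 0, 7, 6, 3, 4, 5])
    (Split 8 7 (Cycle [8, 1, 0, 7]) (Path [3, 4, 5, 7, 0, 1, 8])))))))
    (Path [0, 1, 2, 3, 4, 5, 7])))) (Split 7 4 (Split 7 1 (Split 7 0 (Grow 5 (Split 8 0
    (Cycle [8, 5, 7, 0]) (Split 8 1 (Cycle [8, 5, 7, 1]) (Split 8 3 (Cycle [8, 5, 4, 3])
    (Split 8 4 (Cycle [8, 5, 7, 4]) (Split 8 2 (Split 8 6 (Cycle [8, 2, 3, 6]) (Split 8 7
    (Cycle [8, 2, 1, 7]) (Path [0, 7, 5, 8, 2, 3, 6]))) (Path [0, 1, 2, 3, 4, 5, 8]))))))) (Grow 5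
    (Split 8 0 (Cycle [8, 5, 7, 4, 3, 2, 1, 0]) (Split 8 1 (Cycle [8, 5, 7, 1]) (Split 8 3
    (Cycle [8, 5, 4, 3]) (Split 8 4 (Cycle [8, 5, 7, 4]) (Split 8 2 (Split 8 6
    (Cycle [8, 2, 3, 6]) (Grow 6 (Split 9 0 (Cycle [9, 6, 3, 4, 5, 7, 1, 0]) (Split 9 1
    (Cycle [9, 6, 3, 4, 5, 8, 2, 1]) (Split 9 4 (Cycle [9, 6, 3, 4]) (Split 9 7
    (Cycle [9, 6, 3, 2, 8, 5, 4, 7]) (Split 9 3 (Grow 6 (Split 10 0
    (Cycle [10, 6, 3, 4, 5, 7, 1, 0]) (Split 10 1 (Cycle [10, 6, 3, 4, 5, 8, 2, 1]) (Split 10 3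
    (Cycle [10, 6, 9, 3]) (Split 10 4 (Cycle [10, 6, 3, 4]) (Split 10 7
    (Cycle [10, 6, 3, 2, 8, 5, 4, 7]) (Path [0, 1, 7, 4, 3, 6, 10])))))))
    (Path [0, 1, 7, 4, 3, 6, 9])))))))) (Path [0, 1, 2, 3, 4, 5, 8])))))))) (Split 7 0
    (Path [5, 7, 0, 1, 2, 3, 6]) (Grow 7 (Split 8 0 (Cycle [8, 7, 5, 4, 3, 2, 1, 0]) (Split 8 3
    (Cycle [8, 7, 4, 3]) (Split 8 4 (Cycle [8, 7, 5, 4]) (Split 8 5 (Cycle [8, 7, 4, 5])
    (Split 8 6 (Split 8 1 (Path [0, 1, 8, 6, 3, 4, 5]) (Split 8 2 (Cycle [8, 6, 3, 2])
    (Path [0, 1, 2, 3, 4, 7, 8]))) (Split 8 1 (Path [0, 1, 8, 7, 4, 3, 6]) (Split 8 2 (Grow 0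
    (Split 9 2 (Cycle [9, 0, 1, 2]) (Split 9 3 (Cycle [9, 0, 1, 2, 8, 7, 4, 3]) (Split 9 4
    (Cycle [9, 0, 1, 2, 8, 7, 5, 4]) (Split 9 5 (Cycle [9, 0, 1, 2, 3, 4, 7, 5]) (Split 9 1
    (Grow 0 (Split 10 1 (Cycle [10, 0, 9, 1]) (Split 10 2 (Cycle [10, 0, 1, 2]) (Split 10 3
    (Cycle [10, 0, 1, 2, 8, 7, 4, 3]) (Split 10 4 (Cycle [10, 0, 1, 2, 8, 7, 5, 4]) (Split 10 5
    (Cycle [10, 0, 1, 2, 3, 4, 7, 5]) (Path [5, 4, 3, 2, 1, 0, 10])))))))
    (Path [5, 4, 3, 2, 1, 0, 9]))))))) (Path [0, 1, 2, 3, 4, 7, 8]))))))))))) (Split 7 1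
    (Split 7 0 (Grow 5 (Split 8 0 (Cycle [8, 5, 7, 0]) (Split 8 1 (Cycle [8, 5, 7, 1]) (Split 8 3
    (Cycle [8, 5, 4, 3]) (Split 8 4 (Cycle [8, 5, 7, 0, 1, 2, 3, 4]) (Split 8 2 (Split 8 6
    (Cycle [8, 2, 3, 6]) (Split 8 7 (Cycle [8, 2, 1, 7]) (Path [0, 7, 5, 8, 2, 3, 6])))
    (Path [0, 1, 2, 3, 4, 5, 8]))))))) (Path [0, 1, 7, 5, 4, 3, 6])) (Split 7 0
    (Path [5, 7, 0, 1, 2, 3, 6]) (Path [0, 1, 2, 3, 4, 5, 7])))))))))))))"

text \<open>Growth starts at the end 6, where an adjacency of 7 to 0 closes an 8-cycle through the
  whole path and one to 4 closes a 4-cycle. The longest branches add eleven vertices, numbered 7 to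
  17.\<close>

definition refutation_7 :: refutation where
  "refutation_7 =
    Grow 6 (Split 7 0 (Cycle [7, 6, 5, 4, 3, 2, 1, 0]) (Split 7 4 (Cycle [7, 6, 5, 4]) (Split 7 3
    (Split 7 1 (Cycle [7, 3, 2, 1]) (Split 7 5 (Cycle [7, 3, 4, 5]) (Split 7 2 (Grow 0 (Split 8 2
    (Cycle [8, 0, 1, 2]) (Split 8 4 (Cycle [8, 0, 1, 2, 7, 6, 5, 4]) (Split 8 5
    (Cycle [8, 0, 1, 2, 7, 3, 4, 5]) (Split 8 6 (Cycle [8, 0, 1, 2, 3, 4, 5, 6]) (Split 8 1
    (Grow 0 (Split 9 1 (Cycle [9, 0, 8, 1]) (Split 9 2 (Cycle [9, 0, 1, 2]) (Split 9 4
    (Cycle [9, 0, 1, 2, 7, 6, 5, 4]) (Split 9 5 (Cycle [9, 0, 1, 2, 7, 3, 4, 5]) (Split 9 6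
    (Cycle [9, 0, 1, 2, 3, 4, 5, 6]) (Split 9 3 (Split 9 7 (Cycle [9, 3, 2, 7])
    (Path [4, 5, 6, 7, 2, 1, 0, 9])) (Path [6, 5, 4, 3, 2, 1, 0, 9])))))))) (Split 8 3 (Split 8 7
    (Cycle [8, 3, 2, 7]) (Path [4, 5, 6, 7, 2, 1, 0, 8])) (Path [6, 5, 4, 3, 2, 1, 0, 8]))))))))
    (Grow 4 (Split 8 1 (Cycle [8, 4, 5, 6, 7, 3, 2, 1]) (Split 8 2 (Cycle [8, 4, 3, 2]) (Split 8 6
    (Cycle [8, 4, 5, 6]) (Split 8 7 (Cycle [8, 4, 3, 7]) (Split 8 5 (Split 8 0
    (Cycle [8, 5, 6, 7, 3, 2, 1, 0]) (Split 8 3 (Cycle [8, 5, 4, 3])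
    (Path [0, 1, 2, 3, 7, 6, 5, 8]))) (Split 8 0 (Path [2, 1, 0, 8, 4, 5, 6, 7]) (Split 8 3
    (Grow 8 (Split 9 2 (Cycle [9, 8, 3, 2]) (Split 9 3 (Cycle [9, 8, 4, 3]) (Split 9 4
    (Cycle [9, 8, 3, 4]) (Split 9 5 (Cycle [9, 8, 4, 5]) (Split 9 7 (Cycle [9, 8, 3, 7])
    (Split 9 6 (Split 9 0 (Cycle [9, 6, 5, 4, 3, 2, 1, 0]) (Split 9 1
    (Cycle [9, 6, 5, 4, 8, 3, 2, 1]) (Path [0, 1, 2, 3, 4, 5, 6, 9]))) (Split 9 1
    (Path [2, 1, 9, 8, 4, 5, 6, 7]) (Split 9 0 (Path [6, 5, 4, 3, 2, 1, 0, 9]) (Grow 6 (Split 10 0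
    (Cycle [10, 6, 5, 4, 3, 2, 1, 0]) (Split 10 1 (Cycle [10, 6, 5, 4, 8, 3, 2, 1]) (Split 10 3
    (Cycle [10, 6, 7, 3]) (Split 10 4 (Cycle [10, 6, 5, 4]) (Split 10 5 (Split 10 7
    (Cycle [10, 5, 6, 7]) (Split 10 9 (Cycle [10, 5, 6, 7, 3, 4, 8, 9]) (Grow 7 (Split 11 4
    (Cycle [11, 7, 3, 4]) (Split 11 5 (Cycle [11, 7, 6, 5]) (Split 11 6
    (Cycle [11, 7, 3, 8, 4, 5, 10, 6]) (Split 11 8 (Cycle [11, 7, 3, 8]) (Split 11 9
    (Cycle [11, 7, 6, 5, 4, 3, 8, 9]) (Grow 9 (Split 12 0 (Cycle [12, 9, 8, 4, 3, 2, 1, 0])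
    (Split 12 3 (Cycle [12, 9, 8, 3]) (Split 12 4 (Cycle [12, 9, 8, 4]) (Split 12 5
    (Cycle [12, 9, 8, 4, 3, 7, 6, 5]) (Split 12 6 (Cycle [12, 9, 8, 3, 4, 5, 10, 6]) (Split 12 7
    (Cycle [12, 9, 8, 3, 4, 5, 6, 7]) (Split 12 10 (Cycle [12, 9, 8, 3, 4, 5, 6, 10]) (Split 12 11
    (Cycle [12, 9, 8, 4, 5, 6, 7, 11]) (Split 12 8 (Split 12 1 (Path [0, 1, 12, 8, 3, 7, 6, 5])
    (Split 12 2 (Cycle [12, 8, 3, 2]) (Grow 12 (Split 13 4 (Cycle [13, 12, 8, 4]) (Split 13 5
    (Cycle [13, 12, 8, 4, 3, 7, 6, 5]) (Split 13 6 (Cycle [13, 12, 9, 8, 3, 4, 5, 6]) (Split 13 7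
    (Cycle [13, 12, 8, 3, 4, 5, 6, 7]) (Split 13 8 (Cycle [13, 12, 9, 8]) (Split 13 11
    (Cycle [13, 12, 8, 4, 5, 6, 7, 11]) (Path [11, 7, 6, 5, 4, 8, 12, 13]))))))))))
    (Path [11, 7, 6, 5, 4, 8, 9, 12]))))))))))))))))))) (Split 10 2 (Split 10 8
    (Cycle [10, 2, 3, 8]) (Path [0, 1, 2, 10, 6, 5, 4, 8]))
    (Path [0, 1, 2, 3, 4, 5, 6, 10]))))))))))))))))) (Grow 0 (Split 9 2 (Cycle [9, 0, 1, 2])
    (Split 9 5 (Cycle [9, 0, 1, 2, 3, 7, 6, 5]) (Split 9 6 (Cycle [9, 0, 1, 2, 3, 4, 5, 6])
    (Split 9 1 (Split 9 3 (Cycle [9, 1, 2, 3]) (Split 9 4 (Cycle [9, 1, 2, 3, 7, 6, 5, 4])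
    (Split 9 7 (Cycle [9, 1, 2, 3, 4, 5, 6, 7]) (Split 9 8 (Path [5, 6, 7, 3, 2, 1, 9, 8]) (Grow 9
    (Split 10 0 (Cycle [10, 9, 1, 0]) (Split 10 1 (Cycle [10, 9, 0, 1]) (Split 10 2
    (Cycle [10, 9, 1, 2]) (Split 10 5 (Cycle [10, 9, 0, 1, 2, 3, 4, 5]) (Split 10 6
    (Cycle [10, 9, 0, 1, 2, 3, 7, 6]) (Split 10 8 (Cycle [10, 9, 0, 1, 2, 3, 4, 8]) (Split 10 4
    (Split 10 7 (Cycle [10, 4, 3, 7]) (Path [2, 1, 9, 10, 4, 5, 6, 7])) (Split 10 3 (Grow 6
    (Split 11 0 (Cycle [11, 6, 5, 4, 3, 2, 1, 0]) (Split 11 1 (Cycle [11, 6, 7, 3, 10, 9, 0, 1])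
    (Split 11 2 (Cycle [11, 6, 7, 3, 10, 9, 1, 2]) (Split 11 3 (Cycle [11, 6, 7, 3]) (Split 11 4
    (Cycle [11, 6, 5, 4]) (Split 11 5 (Split 11 7 (Cycle [11, 5, 6, 7]) (Split 11 8
    (Cycle [11, 5, 4, 8]) (Split 11 9 (Cycle [11, 5, 4, 3, 2, 1, 0, 9]) (Split 11 10
    (Cycle [11, 5, 4, 3, 2, 1, 9, 10]) (Grow 11 (Split 12 0 (Cycle [12, 11, 5, 4, 3, 2, 1, 0])
    (Split 12 1 (Cycle [12, 11, 6, 5, 4, 3, 2, 1]) (Split 12 4 (Cycle [12, 11, 5, 4]) (Split 12 5
    (Cycle [12, 11, 6, 5]) (Split 12 8 (Cycle [12, 11, 5, 6, 7, 3, 4, 8]) (Split 12 2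
    (Path [0, 1, 2, 12, 11, 5, 4, 8]) (Split 12 3 (Grow 8 (Split 13 0
    (Cycle [13, 8, 4, 3, 2, 1, 9, 0]) (Split 13 1 (Cycle [13, 8, 4, 3, 10, 9, 0, 1]) (Split 13 2
    (Cycle [13, 8, 4, 5, 6, 7, 3, 2]) (Split 13 3 (Cycle [13, 8, 4, 3]) (Split 13 5
    (Cycle [13, 8, 4, 5]) (Split 13 6 (Cycle [13, 8, 4, 3, 12, 11, 5, 6]) (Split 13 7
    (Cycle [13, 8, 4, 5, 11, 12, 3, 7]) (Split 13 9 (Cycle [13, 8, 4, 3, 2, 1, 0, 9]) (Split 13 10
    (Cycle [13, 8, 4, 3, 2, 1, 9, 10]) (Split 13 11 (Cycle [13, 8, 4, 3, 7, 6, 5, 11])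
    (Split 13 12 (Cycle [13, 8, 4, 5, 6, 7, 3, 12]) (Split 13 4 (Grow 0 (Split 14 1
    (Cycle [14, 0, 9, 1]) (Split 14 2 (Cycle [14, 0, 1, 2]) (Split 14 5
    (Cycle [14, 0, 1, 2, 3, 7, 6, 5]) (Split 14 8 (Cycle [14, 0, 9, 1, 2, 3, 4, 8]) (Split 14 11
    (Cycle [14, 0, 1, 2, 3, 4, 5, 11]) (Split 14 12 (Split 14 4 (Cycle [14, 12, 3, 4])
    (Path [2, 1, 0, 14, 12, 11, 5, 4])) (Split 14 3 (Grow 8 (Split 15 0
    (Cycle [15, 8, 4, 3, 2, 1, 9, 0]) (Split 15 1 (Cycle [15, 8, 4, 3, 10, 9, 0, 1]) (Split 15 2
    (Cycle [15, 8, 4, 3, 14, 0, 1, 2]) (Split 15 3 (Cycle [15, 8, 4, 3]) (Split 15 4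
    (Cycle [15, 8, 13, 4]) (Split 15 5 (Cycle [15, 8, 4, 5]) (Split 15 6
    (Cycle [15, 8, 4, 3, 12, 11, 5, 6]) (Split 15 7 (Cycle [15, 8, 4, 5, 11, 12, 3, 7])
    (Split 15 9 (Cycle [15, 8, 4, 3, 2, 1, 0, 9]) (Split 15 10 (Cycle [15, 8, 4, 3, 2, 1, 9, 10])
    (Split 15 11 (Cycle [15, 8, 4, 3, 7, 6, 5, 11]) (Split 15 12
    (Cycle [15, 8, 4, 5, 6, 7, 3, 12]) (Split 15 13 (Cycle [15, 8, 4, 13]) (Split 15 14
    (Cycle [15, 8, 4, 3, 2, 1, 0, 14]) (Grow 15 (Split 16 3 (Cycle [16, 15, 8, 4, 5, 6, 7, 3])
    (Split 16 4 (Cycle [16, 15, 8, 4]) (Split 16 6 (Cycle [16, 15, 8, 13, 4, 3, 7, 6]) (Split 16 7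
    (Cycle [16, 15, 8, 4, 5, 11, 6, 7]) (Split 16 11 (Cycle [16, 15, 8, 4, 3, 7, 6, 11])
    (Split 16 8 (Grow 15 (Split 17 0 (Cycle [17, 15, 8, 4, 3, 2, 1, 0]) (Split 17 1
    (Cycle [17, 15, 8, 4, 3, 14, 0, 1]) (Split 17 2 (Cycle [17, 15, 16, 8, 13, 4, 3, 2])
    (Split 17 3 (Cycle [17, 15, 8, 4, 5, 6, 7, 3]) (Split 17 4 (Cycle [17, 15, 8, 4]) (Split 17 8
    (Cycle [17, 15, 16, 8]) (Path [0, 1, 2, 3, 4, 8, 15, 17]))))))))
    (Path [11, 6, 7, 3, 4, 8, 15, 16])))))))))))))))))))))))
    (Path [5, 11, 12, 3, 2, 1, 0, 14]))))))))) (Grow 13 (Split 14 0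
    (Cycle [14, 13, 8, 4, 3, 2, 1, 0]) (Split 14 1 (Cycle [14, 13, 8, 4, 3, 10, 9, 1]) (Split 14 3
    (Cycle [14, 13, 8, 4, 5, 6, 7, 3]) (Split 14 4 (Cycle [14, 13, 8, 4]) (Split 14 5
    (Cycle [14, 13, 8, 4, 3, 7, 6, 5]) (Split 14 6 (Cycle [14, 13, 8, 4, 3, 12, 11, 6])
    (Split 14 7 (Cycle [14, 13, 8, 4, 5, 11, 6, 7]) (Split 14 9 (Cycle [14, 13, 8, 4, 3, 2, 1, 9])
    (Split 14 11 (Cycle [14, 13, 8, 4, 3, 7, 6, 11]) (Split 14 8 (Split 14 2
    (Cycle [14, 8, 4, 5, 6, 7, 3, 2]) (Split 14 10 (Cycle [14, 8, 4, 3, 2, 1, 9, 10]) (Split 14 12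
    (Cycle [14, 8, 4, 5, 6, 7, 3, 12]) (Grow 14 (Split 15 0 (Cycle [15, 14, 8, 4, 3, 2, 1, 0])
    (Split 15 1 (Cycle [15, 14, 13, 8, 4, 3, 2, 1]) (Split 15 3 (Cycle [15, 14, 8, 4, 5, 6, 7, 3])
    (Split 15 4 (Cycle [15, 14, 8, 4]) (Split 15 5 (Cycle [15, 14, 8, 4, 3, 7, 6, 5]) (Split 15 8
    (Cycle [15, 14, 13, 8]) (Split 15 2 (Path [0, 1, 2, 15, 14, 8, 4, 5])
    (Path [0, 1, 2, 3, 4, 8, 14, 15]))))))))))))
    (Path [11, 6, 7, 3, 4, 8, 13, 14])))))))))))))))))))))))))
    (Path [0, 1, 2, 3, 4, 5, 11, 12]))))))))))))) (Path [0, 1, 2, 3, 4, 5, 6, 11]))))))))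
    (Path [6, 5, 4, 3, 2, 1, 9, 10])))))))))))))) (Split 9 4 (Split 9 7 (Cycle [9, 4, 3, 7])
    (Path [2, 1, 0, 9, 4, 5, 6, 7])) (Split 9 3 (Split 9 8 (Cycle [9, 3, 4, 8]) (Grow 5
    (Split 10 0 (Cycle [10, 5, 6, 7, 3, 2, 1, 0]) (Split 10 1 (Cycle [10, 5, 6, 7, 3, 9, 0, 1])
    (Split 10 2 (Cycle [10, 5, 4, 3, 9, 0, 1, 2]) (Split 10 3 (Cycle [10, 5, 4, 3]) (Split 10 7
    (Cycle [10, 5, 6, 7]) (Split 10 6 (Split 10 4 (Cycle [10, 6, 5, 4]) (Split 10 8
    (Cycle [10, 5, 4, 8]) (Split 10 9 (Cycle [10, 5, 4, 3, 2, 1, 0, 9]) (Grow 10 (Split 11 0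
    (Cycle [11, 10, 5, 4, 3, 2, 1, 0]) (Split 11 1 (Cycle [11, 10, 6, 5, 4, 3, 2, 1]) (Split 11 4
    (Cycle [11, 10, 5, 4]) (Split 11 5 (Cycle [11, 10, 6, 5]) (Split 11 8
    (Cycle [11, 10, 5, 6, 7, 3, 4, 8]) (Split 11 2 (Path [0, 1, 2, 11, 10, 5, 4, 8]) (Split 11 3
    (Grow 1 (Split 12 3 (Cycle [12, 1, 2, 3]) (Split 12 4 (Cycle [12, 1, 2, 3, 7, 6, 5, 4])
    (Split 12 5 (Cycle [12, 1, 0, 9, 3, 7, 6, 5]) (Split 12 6 (Cycle [12, 1, 0, 9, 3, 4, 5, 6])
    (Split 12 7 (Cycle [12, 1, 2, 3, 4, 5, 6, 7]) (Split 12 9 (Cycle [12, 1, 0, 9]) (Split 12 0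
    (Split 12 2 (Cycle [12, 0, 1, 2]) (Split 12 8 (Path [5, 6, 7, 3, 2, 1, 12, 8]) (Split 12 10
    (Cycle [12, 0, 1, 2, 3, 4, 5, 10]) (Split 12 11 (Cycle [12, 1, 2, 3, 4, 5, 10, 11]) (Grow 12
    (Split 13 8 (Cycle [13, 12, 0, 1, 2, 3, 4, 8]) (Grow 8 (Split 14 0
    (Cycle [14, 8, 4, 3, 2, 1, 12, 0]) (Split 14 1 (Cycle [14, 8, 4, 3, 9, 0, 12, 1]) (Split 14 2
    (Cycle [14, 8, 4, 3, 9, 0, 1, 2]) (Split 14 3 (Cycle [14, 8, 4, 3]) (Split 14 5
    (Cycle [14, 8, 4, 5]) (Split 14 6 (Cycle [14, 8, 4, 3, 11, 10, 5, 6]) (Split 14 7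
    (Cycle [14, 8, 4, 5, 10, 11, 3, 7]) (Split 14 9 (Cycle [14, 8, 4, 3, 2, 1, 0, 9]) (Split 14 10
    (Cycle [14, 8, 4, 3, 7, 6, 5, 10]) (Split 14 11 (Cycle [14, 8, 4, 5, 6, 7, 3, 11])
    (Split 14 12 (Cycle [14, 8, 4, 3, 2, 1, 0, 12]) (Split 14 13
    (Cycle [14, 8, 4, 3, 2, 1, 12, 13]) (Split 14 4 (Grow 8 (Split 15 0
    (Cycle [15, 8, 4, 3, 2, 1, 12, 0]) (Split 15 1 (Cycle [15, 8, 4, 3, 9, 0, 12, 1]) (Split 15 2
    (Cycle [15, 8, 4, 3, 9, 0, 1, 2]) (Split 15 3 (Cycle [15, 8, 4, 3]) (Split 15 4
    (Cycle [15, 8, 14, 4]) (Split 15 5 (Cycle [15, 8, 4, 5]) (Split 15 6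
    (Cycle [15, 8, 4, 3, 11, 10, 5, 6]) (Split 15 7 (Cycle [15, 8, 4, 5, 10, 11, 3, 7])
    (Split 15 9 (Cycle [15, 8, 4, 3, 2, 1, 0, 9]) (Split 15 10 (Cycle [15, 8, 4, 3, 7, 6, 5, 10])
    (Split 15 11 (Cycle [15, 8, 4, 5, 6, 7, 3, 11]) (Split 15 12
    (Cycle [15, 8, 4, 3, 2, 1, 0, 12]) (Split 15 13 (Cycle [15, 8, 4, 3, 2, 1, 12, 13])
    (Split 15 14 (Cycle [15, 8, 4, 14]) (Grow 15 (Split 16 3 (Cycle [16, 15, 8, 4, 5, 6, 7, 3])
    (Split 16 4 (Cycle [16, 15, 8, 4]) (Split 16 6 (Cycle [16, 15, 8, 4, 3, 11, 10, 6])
    (Split 16 7 (Cycle [16, 15, 8, 4, 5, 10, 6, 7]) (Split 16 10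
    (Cycle [16, 15, 8, 4, 3, 7, 6, 10]) (Split 16 8 (Grow 15 (Split 17 0
    (Cycle [17, 15, 8, 4, 3, 2, 1, 0]) (Split 17 1 (Cycle [17, 15, 8, 4, 3, 9, 0, 1]) (Split 17 2
    (Cycle [17, 15, 16, 8, 14, 4, 3, 2]) (Split 17 3 (Cycle [17, 15, 8, 4, 5, 6, 7, 3])
    (Split 17 4 (Cycle [17, 15, 8, 4]) (Split 17 8 (Cycle [17, 15, 16, 8])
    (Path [0, 1, 2, 3, 4, 8, 15, 17]))))))))
    (Path [10, 6, 7, 3, 4, 8, 15, 16]))))))))))))))))))))))) (Grow 14 (Split 15 0
    (Cycle [15, 14, 8, 4, 3, 2, 1, 0]) (Split 15 1 (Cycle [15, 14, 8, 4, 3, 9, 0, 1]) (Split 15 3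
    (Cycle [15, 14, 8, 4, 5, 6, 7, 3]) (Split 15 4 (Cycle [15, 14, 8, 4]) (Split 15 5
    (Cycle [15, 14, 8, 4, 3, 7, 6, 5]) (Split 15 6 (Cycle [15, 14, 8, 4, 3, 11, 10, 6])
    (Split 15 7 (Cycle [15, 14, 8, 4, 5, 10, 6, 7]) (Split 15 10
    (Cycle [15, 14, 8, 4, 3, 7, 6, 10]) (Split 15 8 (Split 15 2 (Cycle [15, 8, 4, 3, 9, 0, 1, 2])
    (Split 15 9 (Cycle [15, 8, 4, 3, 2, 1, 0, 9]) (Split 15 11 (Cycle [15, 8, 4, 5, 6, 7, 3, 11])
    (Split 15 12 (Cycle [15, 8, 4, 3, 2, 1, 0, 12]) (Split 15 13
    (Cycle [15, 8, 4, 3, 2, 1, 12, 13]) (Grow 15 (Split 16 0 (Cycle [16, 15, 8, 4, 3, 2, 1, 0])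
    (Split 16 1 (Cycle [16, 15, 8, 4, 3, 9, 0, 1]) (Split 16 3 (Cycle [16, 15, 8, 4, 5, 6, 7, 3])
    (Split 16 4 (Cycle [16, 15, 8, 4]) (Split 16 5 (Cycle [16, 15, 8, 4, 3, 7, 6, 5]) (Split 16 8
    (Cycle [16, 15, 14, 8]) (Split 16 2 (Path [0, 1, 2, 16, 15, 8, 4, 5])
    (Path [0, 1, 2, 3, 4, 8, 15, 16]))))))))))))))
    (Path [10, 6, 7, 3, 4, 8, 14, 15])))))))))))))))))))))))))))))))
    (Path [6, 5, 4, 3, 9, 0, 1, 12]))))))))) (Path [0, 1, 2, 3, 4, 5, 10, 11]))))))))))))
    (Path [0, 1, 2, 3, 7, 6, 5, 10]))))))))) (Path [6, 5, 4, 3, 2, 1, 0, 9])))))))))))))))))))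
    (Split 7 5 (Split 7 2 (Grow 6 (Split 8 0 (Cycle [8, 6, 5, 4, 3, 2, 1, 0]) (Split 8 1
    (Cycle [8, 6, 7, 5, 4, 3, 2, 1]) (Split 8 2 (Cycle [8, 6, 7, 2]) (Split 8 4
    (Cycle [8, 6, 5, 4]) (Split 8 5 (Cycle [8, 6, 7, 5]) (Split 8 3 (Grow 0 (Split 9 2
    (Cycle [9, 0, 1, 2]) (Split 9 3 (Cycle [9, 0, 1, 2, 7, 5, 4, 3]) (Split 9 4
    (Cycle [9, 0, 1, 2, 7, 6, 5, 4]) (Split 9 5 (Cycle [9, 0, 1, 2, 3, 8, 6, 5]) (Split 9 6
    (Cycle [9, 0, 1, 2, 3, 4, 5, 6]) (Split 9 1 (Split 9 7 (Cycle [9, 1, 2, 7]) (Split 9 8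
    (Cycle [9, 0, 1, 2, 7, 5, 6, 8]) (Grow 9 (Split 10 1 (Cycle [10, 9, 0, 1]) (Split 10 2
    (Cycle [10, 9, 1, 2]) (Split 10 3 (Cycle [10, 9, 1, 2, 7, 5, 4, 3]) (Split 10 4
    (Cycle [10, 9, 0, 1, 2, 7, 5, 4]) (Split 10 5 (Cycle [10, 9, 0, 1, 2, 3, 4, 5]) (Split 10 6
    (Cycle [10, 9, 0, 1, 2, 3, 8, 6]) (Path [6, 5, 4, 3, 2, 1, 9, 10]))))))))))
    (Path [6, 5, 4, 3, 2, 1, 0, 9])))))))) (Path [0, 1, 2, 3, 4, 5, 6, 8])))))))) (Split 7 1
    (Grow 6 (Split 8 0 (Cycle [8, 6, 5, 4, 3, 2, 1, 0]) (Split 8 1 (Cycle [8, 6, 7, 1]) (Split 8 4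
    (Cycle [8, 6, 5, 4]) (Split 8 5 (Cycle [8, 6, 7, 5]) (Split 8 7 (Cycle [8, 6, 5, 7])
    (Split 8 3 (Grow 4 (Split 9 0 (Cycle [9, 4, 3, 8, 6, 7, 1, 0]) (Split 9 1
    (Cycle [9, 4, 5, 6, 8, 3, 2, 1]) (Split 9 3 (Cycle [9, 4, 5, 6, 7, 1, 2, 3]) (Split 9 6
    (Cycle [9, 4, 5, 6]) (Split 9 7 (Cycle [9, 4, 5, 7]) (Split 9 8 (Cycle [9, 4, 3, 8])
    (Path [0, 1, 7, 6, 8, 3, 4, 9])))))))) (Split 8 2 (Grow 4 (Split 9 0
    (Cycle [9, 4, 5, 6, 8, 2, 1, 0]) (Split 9 1 (Cycle [9, 4, 3, 2, 8, 6, 7, 1]) (Split 9 2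
    (Cycle [9, 4, 3, 2]) (Split 9 5 (Cycle [9, 4, 3, 2, 1, 7, 6, 5]) (Split 9 6
    (Cycle [9, 4, 5, 6]) (Split 9 8 (Cycle [9, 4, 3, 2, 1, 7, 6, 8])
    (Path [0, 1, 2, 8, 6, 5, 4, 9])))))))) (Path [0, 1, 2, 3, 4, 5, 6, 8]))))))))) (Grow 6
    (Split 8 0 (Cycle [8, 6, 5, 4, 3, 2, 1, 0]) (Split 8 1 (Cycle [8, 6, 7, 5, 4, 3, 2, 1])
    (Split 8 4 (Cycle [8, 6, 5, 4]) (Split 8 5 (Cycle [8, 6, 7, 5]) (Split 8 7
    (Cycle [8, 6, 5, 7]) (Split 8 3 (Split 8 2 (Grow 4 (Split 9 0 (Cycle [9, 4, 5, 6, 8, 2, 1, 0])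
    (Split 9 1 (Cycle [9, 4, 5, 6, 8, 3, 2, 1]) (Split 9 2 (Cycle [9, 4, 3, 2]) (Split 9 5
    (Cycle [9, 4, 3, 2, 8, 6, 7, 5]) (Split 9 6 (Cycle [9, 4, 5, 6]) (Split 9 8
    (Cycle [9, 4, 3, 8]) (Path [0, 1, 2, 8, 6, 5, 4, 9])))))))) (Grow 4 (Split 9 1
    (Cycle [9, 4, 5, 6, 8, 3, 2, 1]) (Split 9 2 (Cycle [9, 4, 3, 2]) (Split 9 6
    (Cycle [9, 4, 5, 6]) (Split 9 7 (Cycle [9, 4, 5, 7]) (Split 9 8 (Cycle [9, 4, 3, 8])
    (Split 9 5 (Split 9 0 (Cycle [9, 5, 6, 8, 3, 2, 1, 0]) (Split 9 3 (Cycle [9, 5, 4, 3])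
    (Path [0, 1, 2, 3, 8, 6, 5, 9]))) (Split 9 0 (Path [2, 1, 0, 9, 4, 5, 6, 8]) (Split 9 3
    (Grow 7 (Split 10 0 (Cycle [10, 7, 5, 4, 3, 2, 1, 0]) (Split 10 1
    (Cycle [10, 7, 6, 5, 4, 3, 2, 1]) (Split 10 2 (Cycle [10, 7, 6, 5, 4, 9, 3, 2]) (Split 10 4
    (Cycle [10, 7, 5, 4]) (Split 10 5 (Cycle [10, 7, 6, 5]) (Split 10 3 (Split 10 6
    (Cycle [10, 3, 8, 6]) (Split 10 8 (Cycle [10, 7, 6, 8]) (Split 10 9 (Cycle [10, 3, 4, 9])
    (Grow 8 (Split 11 1 (Cycle [11, 8, 6, 5, 4, 3, 2, 1]) (Split 11 2 (Cycle [11, 8, 3, 2])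
    (Split 11 3 (Cycle [11, 8, 6, 7, 5, 4, 9, 3]) (Split 11 4 (Cycle [11, 8, 3, 4]) (Split 11 5
    (Cycle [11, 8, 6, 5]) (Split 11 6 (Cycle [11, 8, 3, 9, 4, 5, 7, 6]) (Split 11 0
    (Path [6, 5, 4, 3, 2, 1, 0, 11]) (Split 11 7 (Cycle [11, 8, 6, 7]) (Split 11 9
    (Cycle [11, 8, 3, 9]) (Split 11 10 (Cycle [11, 8, 3, 10]) (Grow 9 (Split 12 4
    (Cycle [12, 9, 3, 4]) (Split 12 5 (Cycle [12, 9, 4, 5]) (Split 12 6
    (Cycle [12, 9, 4, 3, 10, 7, 5, 6]) (Split 12 8 (Cycle [12, 9, 3, 8]) (Split 12 10
    (Cycle [12, 9, 3, 10]) (Split 12 11 (Cycle [12, 9, 3, 4, 5, 6, 8, 11]) (Grow 10 (Split 13 11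
    (Cycle [13, 10, 3, 4, 5, 6, 8, 11]) (Grow 11 (Split 14 2 (Cycle [14, 11, 8, 6, 5, 4, 3, 2])
    (Split 14 3 (Cycle [14, 11, 8, 3]) (Split 14 4 (Cycle [14, 11, 8, 3, 10, 7, 5, 4]) (Split 14 5
    (Cycle [14, 11, 8, 3, 10, 7, 6, 5]) (Split 14 6 (Cycle [14, 11, 8, 6]) (Split 14 1
    (Path [6, 5, 4, 3, 2, 1, 14, 11]) (Split 14 0 (Path [6, 5, 4, 3, 2, 1, 0, 14]) (Split 14 7
    (Cycle [14, 11, 8, 3, 4, 5, 6, 7]) (Split 14 9 (Cycle [14, 11, 8, 6, 5, 4, 3, 9]) (Split 14 10
    (Cycle [14, 11, 8, 6, 5, 4, 3, 10]) (Split 14 12 (Cycle [14, 11, 8, 6, 5, 4, 9, 12])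
    (Split 14 8 (Split 14 13 (Cycle [14, 8, 6, 5, 4, 3, 10, 13]) (Grow 14 (Split 15 4
    (Cycle [15, 14, 8, 3, 10, 7, 5, 4]) (Split 15 5 (Cycle [15, 14, 8, 3, 10, 7, 6, 5])
    (Split 15 6 (Cycle [15, 14, 8, 6]) (Split 15 8 (Cycle [15, 14, 11, 8]) (Split 15 9
    (Cycle [15, 14, 8, 6, 5, 4, 3, 9]) (Split 15 12 (Cycle [15, 14, 8, 6, 5, 4, 9, 12])
    (Path [12, 9, 4, 5, 6, 8, 14, 15])))))))))
    (Path [12, 9, 4, 5, 6, 8, 11, 14])))))))))))))))))))))))))))))))))))))
    (Path [0, 1, 2, 3, 4, 5, 7, 10])))))))) (Grow 7 (Split 10 0 (Cycle [10, 7, 5, 4, 3, 2, 1, 0])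
    (Split 10 1 (Cycle [10, 7, 6, 5, 4, 3, 2, 1]) (Split 10 4 (Cycle [10, 7, 5, 4]) (Split 10 5
    (Cycle [10, 7, 6, 5]) (Split 10 9 (Cycle [10, 7, 5, 6, 8, 3, 4, 9]) (Split 10 2
    (Path [0, 1, 2, 10, 7, 5, 4, 9]) (Split 10 3 (Grow 9 (Split 11 2
    (Cycle [11, 9, 4, 5, 6, 8, 3, 2]) (Split 11 3 (Cycle [11, 9, 4, 3]) (Split 11 5
    (Cycle [11, 9, 4, 5]) (Split 11 6 (Cycle [11, 9, 4, 3, 10, 7, 5, 6]) (Split 11 7
    (Cycle [11, 9, 4, 3, 8, 6, 5, 7]) (Split 11 8 (Cycle [11, 9, 4, 5, 7, 10, 3, 8]) (Split 11 1
    (Path [5, 6, 8, 3, 2, 1, 11, 9]) (Split 11 0 (Path [5, 6, 8, 3, 2, 1, 0, 11]) (Split 11 10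
    (Cycle [11, 9, 4, 5, 6, 8, 3, 10]) (Split 11 4 (Grow 11 (Split 12 0
    (Cycle [12, 11, 9, 4, 3, 2, 1, 0]) (Split 12 2 (Cycle [12, 11, 4, 5, 6, 8, 3, 2]) (Split 12 3
    (Cycle [12, 11, 4, 3]) (Split 12 4 (Cycle [12, 11, 9, 4]) (Split 12 5 (Cycle [12, 11, 4, 5])
    (Split 12 6 (Cycle [12, 11, 4, 3, 10, 7, 5, 6]) (Split 12 7 (Cycle [12, 11, 4, 3, 8, 6, 5, 7])
    (Split 12 8 (Cycle [12, 11, 4, 5, 7, 10, 3, 8]) (Split 12 1 (Path [0, 1, 12, 11, 4, 3, 8, 6])
    (Split 12 9 (Cycle [12, 11, 4, 9]) (Split 12 10 (Cycle [12, 11, 4, 5, 6, 8, 3, 10]) (Grow 12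
    (Split 13 3 (Cycle [13, 12, 11, 4, 5, 6, 8, 3]) (Split 13 4 (Cycle [13, 12, 11, 4])
    (Split 13 6 (Cycle [13, 12, 11, 4, 3, 10, 7, 6]) (Split 13 7
    (Cycle [13, 12, 11, 4, 3, 8, 6, 7]) (Split 13 8 (Cycle [13, 12, 11, 4, 5, 7, 6, 8])
    (Split 13 11 (Grow 12 (Split 14 0 (Cycle [14, 12, 11, 4, 3, 2, 1, 0]) (Split 14 1
    (Cycle [14, 12, 11, 9, 4, 3, 2, 1]) (Split 14 2 (Cycle [14, 12, 13, 11, 9, 4, 3, 2])
    (Split 14 3 (Cycle [14, 12, 11, 4, 5, 6, 8, 3]) (Split 14 4 (Cycle [14, 12, 11, 4])
    (Split 14 11 (Cycle [14, 12, 13, 11]) (Path [0, 1, 2, 3, 4, 11, 12, 14]))))))))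
    (Path [7, 6, 8, 3, 4, 11, 12, 13])))))))))))))))))))) (Grow 11 (Split 12 3
    (Cycle [12, 11, 9, 4, 5, 6, 8, 3]) (Split 12 4 (Cycle [12, 11, 9, 4]) (Split 12 6
    (Cycle [12, 11, 9, 4, 3, 10, 7, 6]) (Split 12 7 (Cycle [12, 11, 9, 4, 3, 8, 6, 7]) (Split 12 8
    (Cycle [12, 11, 9, 4, 5, 7, 6, 8]) (Split 12 9 (Grow 11 (Split 13 3
    (Cycle [13, 11, 9, 4, 5, 6, 8, 3]) (Split 13 4 (Cycle [13, 11, 9, 4]) (Split 13 6
    (Cycle [13, 11, 9, 4, 3, 10, 7, 6]) (Split 13 7 (Cycle [13, 11, 9, 4, 3, 8, 6, 7]) (Split 13 8
    (Cycle [13, 11, 9, 4, 5, 7, 6, 8]) (Split 13 9 (Cycle [13, 11, 12, 9])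
    (Path [7, 6, 8, 3, 4, 9, 11, 13])))))))) (Path [7, 6, 8, 3, 4, 9, 11, 12])))))))))))))))))))
    (Path [0, 1, 2, 3, 4, 5, 7, 10]))))))))))))))))))) (Split 8 2 (Grow 4 (Split 9 0
    (Cycle [9, 4, 5, 6, 8, 2, 1, 0]) (Split 9 1 (Cycle [9, 4, 5, 7, 6, 8, 2, 1]) (Split 9 2
    (Cycle [9, 4, 3, 2]) (Split 9 5 (Cycle [9, 4, 3, 2, 8, 6, 7, 5]) (Split 9 6
    (Cycle [9, 4, 5, 6]) (Split 9 7 (Cycle [9, 4, 5, 7]) (Split 9 8
    (Path [0, 1, 2, 8, 9, 4, 5, 7]) (Path [0, 1, 2, 8, 6, 5, 4, 9])))))))))
    (Path [0, 1, 2, 3, 4, 5, 6, 8]))))))))))) (Split 7 1 (Grow 6 (Split 8 0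
    (Cycle [8, 6, 5, 4, 3, 2, 1, 0]) (Split 8 1 (Cycle [8, 6, 7, 1]) (Split 8 4
    (Cycle [8, 6, 5, 4]) (Split 8 5 (Cycle [8, 6, 7, 1, 2, 3, 4, 5]) (Split 8 7
    (Cycle [8, 6, 5, 4, 3, 2, 1, 7]) (Split 8 2 (Grow 4 (Split 9 0
    (Cycle [9, 4, 5, 6, 8, 2, 1, 0]) (Split 9 1 (Cycle [9, 4, 3, 2, 8, 6, 7, 1]) (Split 9 2
    (Cycle [9, 4, 3, 2]) (Split 9 5 (Cycle [9, 4, 3, 2, 1, 7, 6, 5]) (Split 9 6
    (Cycle [9, 4, 5, 6]) (Split 9 8 (Cycle [9, 4, 3, 2, 1, 7, 6, 8])
    (Path [0, 1, 2, 8, 6, 5, 4, 9])))))))) (Split 8 3 (Grow 8 (Split 9 1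
    (Cycle [9, 8, 6, 5, 4, 3, 2, 1]) (Split 9 2 (Cycle [9, 8, 3, 2]) (Split 9 4
    (Cycle [9, 8, 3, 4]) (Split 9 5 (Cycle [9, 8, 6, 5]) (Split 9 7 (Cycle [9, 8, 6, 7])
    (Split 9 6 (Split 9 0 (Cycle [9, 6, 5, 4, 3, 2, 1, 0]) (Split 9 3 (Cycle [9, 6, 8, 3])
    (Path [0, 1, 2, 3, 4, 5, 6, 9]))) (Split 9 0 (Path [2, 1, 0, 9, 8, 6, 5, 4]) (Split 9 3
    (Path [0, 1, 7, 6, 5, 4, 3, 9]) (Grow 4 (Split 10 0 (Cycle [10, 4, 3, 8, 6, 7, 1, 0])
    (Split 10 1 (Cycle [10, 4, 5, 6, 8, 3, 2, 1]) (Split 10 3 (Cycle [10, 4, 5, 6, 7, 1, 2, 3])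
    (Split 10 6 (Cycle [10, 4, 5, 6]) (Split 10 8 (Cycle [10, 4, 3, 8]) (Split 10 7 (Split 10 9
    (Cycle [10, 7, 6, 5, 4, 3, 8, 9]) (Path [0, 1, 7, 10, 4, 3, 8, 9]))
    (Path [0, 1, 7, 6, 8, 3, 4, 10]))))))))))))))))) (Path [0, 1, 2, 3, 4, 5, 6, 8])))))))))
    (Split 7 2 (Grow 0 (Split 8 2 (Cycle [8, 0, 1, 2]) (Split 8 4 (Cycle [8, 0, 1, 2, 7, 6, 5, 4])
    (Split 8 6 (Cycle [8, 0, 1, 2, 3, 4, 5, 6]) (Split 8 3 (Split 8 1 (Cycle [8, 3, 2, 1])
    (Split 8 5 (Cycle [8, 3, 4, 5]) (Split 8 7 (Cycle [8, 3, 2, 7])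
    (Path [4, 5, 6, 7, 2, 1, 0, 8])))) (Split 8 5 (Grow 0 (Split 9 1
    (Cycle [9, 0, 8, 5, 4, 3, 2, 1]) (Split 9 2 (Cycle [9, 0, 1, 2]) (Split 9 3
    (Cycle [9, 0, 8, 5, 6, 7, 2, 3]) (Split 9 4 (Cycle [9, 0, 1, 2, 7, 6, 5, 4]) (Split 9 5
    (Cycle [9, 0, 8, 5]) (Split 9 6 (Cycle [9, 0, 1, 2, 3, 4, 5, 6])
    (Path [6, 5, 4, 3, 2, 1, 0, 9])))))))) (Split 8 1 (Split 8 7 (Cycle [8, 1, 2, 7]) (Grow 8
    (Split 9 0 (Cycle [9, 8, 1, 0]) (Split 9 1 (Cycle [9, 8, 0, 1]) (Split 9 2
    (Cycle [9, 8, 1, 2]) (Split 9 4 (Cycle [9, 8, 1, 2, 7, 6, 5, 4]) (Split 9 5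
    (Cycle [9, 8, 0, 1, 2, 3, 4, 5]) (Split 9 6 (Cycle [9, 8, 1, 2, 3, 4, 5, 6]) (Split 9 3
    (Split 9 7 (Cycle [9, 3, 2, 7]) (Path [0, 8, 9, 3, 2, 7, 6, 5]))
    (Path [6, 5, 4, 3, 2, 1, 8, 9])))))))))) (Path [6, 5, 4, 3, 2, 1, 0, 8]))))))))
    (Path [0, 1, 2, 3, 4, 5, 6, 7])))))))"

section \<open>Evaluation of the checker on the six trees\<close>

lemma refutes_path_2: "refutes 3 2 (path_edges 2) (path_nonedges 2) refutation_2"
  \<comment> \<open>All arguments are closed terms, so the claim is a computation. The first
    argument exceeds the second by one: it is the length of the path that a \<open>Path\<close> leaf
    must exhibit.\<close>
  by code_simp

lemma refutes_path_3: "refutes 4 3 (path_edges 3) (path_nonedges 3) refutation_3"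
  by code_simp

lemma refutes_path_4: "refutes 5 4 (path_edges 4) (path_nonedges 4) refutation_4"
  by code_simp

lemma refutes_path_5: "refutes 6 5 (path_edges 5) (path_nonedges 5) refutation_5"
  by code_simp

lemma refutes_path_6: "refutes 7 6 (path_edges 6) (path_nonedges 6) refutation_6"
  by code_simp

lemma refutes_path_7: "refutes 8 7 (path_edges 7) (path_nonedges 7) refutation_7"
  by code_simp

section \<open>Cycles and induced paths in graphs\<close>

text \<open>Walks of the library are lists of arcs, so one arc is chosen for each consecutive pair.
  A one-element list becomes the empty arc walk, for which \<open>hd vs \<in> verts G\<close> has to
  be known separately.\<close>

lemma (in wf_digraph) successively_imp_awalk:
  assumes "vs \<noteq> []" "hd vs \<in> verts G" "successively (dominates G) vs"
  shows "\<exists>p. awalk (hd vs) p (last vs) \<and> awalk_verts (hd vs) p = vs"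
  using assms
proof (induction vs rule: induct_list012)
  case (2 v)
  then show ?case
    by (auto simp: awalk_Nil_iff intro!: exI[of _ "[]"])
next
  case (3 u v vs)
  then obtain p where p: "awalk v p (last (v # vs))" "awalk_verts v p = v # vs"
    by (auto intro: adj_in_verts)
  moreover obtain e where "e \<in> arcs G" "tail G e = u" "head G e = v"
    using 3 by (auto simp: arcs_ends_conv)
  ultimately have "awalk u (e # p) (last (v # vs)) \<and> awalk_verts u (e # p) = u # v # vs"
    by (auto simp: awalk_Cons_iff)
  then show ?case
    by (auto intro!: exI[of _ "e # p"])
qed simp

lemma (in wf_digraph) closed_walk_imp_has_cycle:
  assumes "closed_walk (dominates G) vs" "distinct vs" "3 \<le> length vs"
  shows "has_cycle_of_length G (length vs)"
proof -
  have ne: "vs \<noteq> []"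
    using assms(3) by auto
  \<comment> \<open>Repeating the first vertex at the end makes the closing edge an ordinary step.
    The walk then visits \<open>length vs + 1\<close> vertices and has \<open>length vs\<close>
    arcs.\<close>
  let ?ws = "vs @ [hd vs]"
  have "successively (dominates G) ?ws" "hd vs \<in> verts G"
    using assms ne by (auto simp: closed_walk_def successively_append_iff intro: adj_in_verts)
  then obtain p where p: "awalk (hd vs) p (hd vs)" "awalk_verts (hd vs) p = ?ws"
    using successively_imp_awalk[of ?ws] ne by auto
  have len: "length p = length vs"
    using length_awalk_verts[of "hd vs" p] p(2) by simp
  \<comment> \<open>Dropping the first visit leaves \<open>vs\<close> rotated by one place.\<close>
  have "distinct (tl (awalk_verts (hd vs) p))"
    using p(2) ne assms(2) by (cases vs) auto
  then have "cycle p"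
    using p(1) len ne unfolding cycle_def by auto
  then show ?thesis
    using len assms(3) unfolding has_cycle_of_length_def by auto
qed

text \<open>The subgraph induced on \<open>set vs\<close> is isomorphic to the path graph by sending
  each vertex to its position and each arc to the pair of positions of its ends.\<close>

lemma (in graph) induced_path_imp_not_induced_free:
  assumes "induced_path (dominates G) (\<lambda>u v. \<not> dominates G u v) vs"
    and "distinct vs" "set vs \<subseteq> verts G"
  shows "\<not> induced_free (path_graph (length vs)) G"
proof -
  define k where "k = length vs"
  define K where "K = G \<restriction> set vs"
  have sub: "induced_subgraph K G"
    unfolding K_def using assms(3) by (rule induced_induce)
  define idx where "idx = the_inv_into {..<k} ((!) vs)"
  have inj: "inj_on ((!) vs) {..<k}" and img: "(!) vs ` {..<k} = set vs"
    using assms(2) by (auto simp: k_def inj_on_def nth_eq_iff_index_eq set_conv_nth)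
  have idx_nth: "idx (vs ! i) = i" if "i < k" for i
    unfolding idx_def using inj that by (intro the_inv_into_f_f) auto
  \<comment> \<open>\<open>induced_path\<close> speaks only of pairs in list order. Symmetry covers
    the reversed pairs and the absence of loops covers equal positions.\<close>
  have adj_iff: "dominates G (vs ! i) (vs ! j) \<longleftrightarrow> j = Suc i \<or> i = Suc j"
    if "i < k" "j < k" for i j
  proof -
    have step: "dominates G (vs ! i) (vs ! Suc i)" if "Suc i < k" for i
      using assms(1) that by (auto simp: induced_path_conv_nth k_def)
    have far: "\<not> dominates G (vs ! i) (vs ! j)" if "Suc i < j" "j < k" for i j
      using assms(1) that by (auto simp: induced_path_conv_nth k_def)
    consider "j = Suc i" | "i = Suc j" | "i = j" | "Suc i < j" | "Suc j < i"
      by linarith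
    then show ?thesis
    proof cases
      case 3
      then show ?thesis
        by (auto dest: adj_not_same)
    qed (use step far that in \<open>auto dest: arcs_ends_symmetric[OF sym_arcs]\<close>)
  qed
  \<comment> \<open>Arcs of \<open>path_graph\<close> are themselves pairs with projections as tail
    and head; this dictates \<open>iso_arcs\<close>, \<open>iso_tail\<close> and
    \<open>iso_head\<close>.\<close>
  define h where "h = \<lparr> iso_verts = idx, iso_arcs = (\<lambda>e. (idx (tail G e), idx (head G e))),
    iso_head = snd, iso_tail = fst \<rparr>"
  have inj_idx: "inj_on idx (set vs)"
    unfolding img[symmetric] using idx_nth by (auto simp: inj_on_def)
  \<comment> \<open>Arcs with the same image have the same ends, because \<open>idx\<close> is
    injective, and parallel arcs do not exist.\<close>
  have "inj_on (iso_arcs h) (arcs K)"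
    using inj_idx
    by (auto simp: h_def K_def inj_on_def arc_to_ends_def intro!: no_multi_arcs)
  then have "pre_digraph.digraph_isomorphism K h"
    using inj_idx
    by (auto simp: pre_digraph.digraph_isomorphism_def h_def K_def intro: wellformed_induce_subgraph)
  moreover have "path_graph k = app_iso h K"
  proof -
    have "idx ` set vs = {..<k}"
      unfolding img[symmetric] image_image using idx_nth by (auto simp: image_iff)
    moreover have "iso_arcs h ` arcs K = {(i, j). i < k \<and> j < k \<and> (j = Suc i \<or> i = Suc j)}"
      (is "_ = ?A")
    proof (intro equalityI subsetI)
      fix a assume "a \<in> iso_arcs h ` arcs K"
      then obtain e where e: "e \<in> arcs G" "tail G e \<in> set vs" "head G e \<in> set vs"
        and a: "a = (idx (tail G e), idx (head G e))"
        by (auto simp: h_def K_def)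
      obtain i j where ij: "i < k" "j < k" "tail G e = vs ! i" "head G e = vs ! j"
        using e(2,3) by (auto simp: in_set_conv_nth k_def)
      then have "dominates G (vs ! i) (vs ! j)"
        using e(1) unfolding arcs_ends_conv by force
      then show "a \<in> ?A"
        using ij a adj_iff idx_nth by auto
    next
      fix a assume "a \<in> ?A"
      then obtain i j where ij: "a = (i, j)" "i < k" "j < k" "j = Suc i \<or> i = Suc j"
        by auto
      then have "dominates G (vs ! i) (vs ! j)"
        using adj_iff by blast
      then obtain e where "e \<in> arcs G" "tail G e = vs ! i" "head G e = vs ! j"
        by (auto simp: arcs_ends_conv)
      then have "e \<in> arcs K" "iso_arcs h e = a"
        using ij idx_nth by (auto simp: K_def h_def k_def)
      then show "a \<in> iso_arcs h ` arcs K"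
        by blast
    qed
    ultimately show ?thesis
      by (auto simp: path_graph_def app_iso_def with_proj_def h_def K_def)
  qed
  ultimately have "digraph_iso K (path_graph k)"
    unfolding digraph_iso_def by blast
  then show ?thesis
    using sub unfolding induced_free_def k_def by blast
qed

text \<open>The graph without vertices satisfies the degree condition vacuously and has no cycle,
  whence the assumption of nonemptiness; it also yields the first edge.\<close>

theorem theorem1p2:
  fixes G :: "('a, 'b) pre_digraph"
  assumes "graph G"
    and "verts G \<noteq> {}"
    and "induced_free (path_graph 8) G"
    and "\<And>v. v \<in> verts G \<Longrightarrow> 3 \<le> out_degree G v"
  shows "has_cycle_of_length G 4 \<or> has_cycle_of_length G 8"
proof (rule ccontr)
  assume contr: "\<not> ?thesis"
  interpret graph G
    by fact
  let ?adj = "dominates G"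
  let ?nonadj = "\<lambda>u v. \<not> ?adj u v"
  have deg: "3 \<le> card {w. ?adj v w}" if "v \<in> verts G" for v
  proof -
    \<comment> \<open>Out-degree counts arcs, whereas the case trees need distinct neighbours. The
      two counts agree in the absence of parallel arcs.\<close>
    have "inj_on (head G) (out_arcs G v)"
      by (auto simp: inj_on_def arc_to_ends_def intro: no_multi_arcs)
    moreover have "head G ` out_arcs G v = {w. ?adj v w}"
      by (auto simp: arcs_ends_conv)
    ultimately show ?thesis
      using assms(4)[OF that] by (metis card_image out_degree_def)
  qed
  have no_cycle: "\<not> closed_walk ?adj vs" if "length vs = 4 \<or> length vs = 8" "distinct vs" for vs
    using closed_walk_imp_has_cycle[of vs] that contr by auto
  define P where "P k \<longleftrightarrow> (\<exists>vs. length vs = k \<and> distinct vs \<and> set vs \<subseteq> verts G \<and>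
    induced_path ?adj ?nonadj vs)" for k
  have "P 2"
  proof -
    obtain v where "v \<in> verts G"
      using assms(2) by blast
    then obtain w where "?adj v w"
      using deg[of v] by fastforce
    then show ?thesis
      unfolding P_def using adj_not_same by (intro exI[of _ "[v, w]"]) (auto intro: adj_in_verts)
  qed
  moreover have "\<not> P 8"
    using induced_path_imp_not_induced_free assms(3) unfolding P_def by metis
  \<comment> \<open>No monotonicity of \<open>P\<close> is involved: a property true at 2 and false
    at 8 is lost at some step in between.\<close>
  ultimately consider "P 2" "\<not> P 3" | "P 3" "\<not> P 4" | "P 4" "\<not> P 5" | "P 5" "\<not> P 6"
    | "P 6" "\<not> P 7" | "P 7" "\<not> P 8"
    by blast
  then obtain k r where "P k" "\<not> P (Suc k)"
    and r: "refutes (Suc k) k (path_edges k) (path_nonedges k) r"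
    using refutes_path_2 refutes_path_3 refutes_path_4 refutes_path_5 refutes_path_6 refutes_path_7
    \<comment> \<open>Unfolding the numerals identifies the excluded lengths 3 to 8 with
      \<open>Suc k\<close>.\<close>
    by cases (use that in \<open>simp_all add: eval_nat_numeral\<close>)
  then obtain vs where vs: "length vs = k" "distinct vs" "set vs \<subseteq> verts G"
      "induced_path ?adj ?nonadj vs"
    unfolding P_def by blast
  show False
  proof (rule refutes_sound)
    show "symp ?adj"
      by (auto simp: symp_def intro: arcs_ends_symmetric)
    show "irreflp ?adj"
      by (auto simp: irreflp_def dest: adj_not_same)
    show "realizes ?adj (verts G) k (path_edges k) (path_nonedges k) ((!) vs)"
      using realizes_path vs by blast
  qed (use \<open>\<not> P (Suc k)\<close> deg no_cycle r in \<open>auto simp: P_def intro: adj_in_verts\<close>)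
qed

end
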